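(* Let a regular $N$-gon (also denoted $N$) be given in standard orientation. Every star point $\mathrm{star}[k]$ of $N$ (taken on the left side, $1\le k<N/2$) defines a tile $S[k]$, that is, a regular polygon in standard orientation which is a regular $N$-gon if $N$ is even and a regular $2N$-gon if $N$ is odd, such that $S[k]$ is strongly conforming relative to $N$ and $S[k]$ has horizontal displacement $-sN/2$ relative to $\mathrm{star}[k]$ (that is, the $x$-coordinate of the center of $S[k]$ equals the $x$-coordinate of the left-side $\mathrm{star}[k]$ of $N$ minus $sN/2$).
   Context: A regular $m$-gon $P$ is in standard orientation if its lowest edge (the base edge) is horizontal. Write $cP$ for its center, $hP$ for its apothem (height), $sP$ for its side length, and $\mathrm{Mid}P=cP-(0,hP)$ for the midpoint of its base edge. For $1\le k<m/2$ the right-side and left-side star points $\mathrm{star}[k]$ of $P$ are $\mathrm{Mid}P+(hP\tan(k\pi/m),0)$ and $\mathrm{Mid}P-(hP\tan(k\pi/m),0)$ respectively (so $\mathrm{star}[1]$ is a vertex of $P$). $\langle m/2\rangle$ denotes the greatest integer strictly less than $m/2$, and $\mathrm{GenStar}$ of $P$ is $\mathrm{star}[\langle m/2\rangle]$ (on the relevant side). Two polygons in standard orientation share the same base edge if their base edges lie on the same horizontal line. Conforming: (i) If $N$ is even, a regular $N$-gon or $N/2$-gon $P$ is conforming relative to $N$ if it shares the same base edge as $N$ and the right-side $\mathrm{GenStar}$ of $P$ is the left-side $\mathrm{star}[1]$ of $N$. (ii) If $N$ is odd, a regular $2N$-gon $P$ is conforming relative to $N$ if it shares the same base edge as $N$ and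 the right-side $\mathrm{star}[N-2]$ of $P$ is the left-side $\mathrm{star}[1]$ of $N$. In both cases $P$ is strongly conforming if it is conforming and also shares another star point with $N$.
   Formalization: For N = 4 (only k = 1) the tile S[1] is claimed to be conforming with the stated displacement, but not strongly conforming: it is the congruent adjacent square, which shares only star[1] with N, so the claim as worded fails there. *)

theory Defs
  imports "HOL-Analysis.Analysis"
begin

(* A polygon is the list of its vertices; its edges join cyclically consecutive entries. *)
type_synonym polygon = "(real \<times> real) list"

definition regular_polygon :: "polygon \<Rightarrow> bool" where
  "regular_polygon P \<longleftrightarrow> length P \<ge> 3 \<and>
     (\<exists>c r \<theta>. r > 0 \<and>
        (\<forall>j<length P. P ! j = c + r *\<^sub>R (cos (\<theta> + 2 * pi * real j / real (length P)),
                                       sin (\<theta> + 2 * pi * real j / real (length P)))))"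

definition center :: "polygon \<Rightarrow> real \<times> real" where
  "center P = (1 / real (length P)) *\<^sub>R (\<Sum>j<length P. P ! j)"

(* For a regular polygon the choice of the edge from vertex 0 to vertex 1 is immaterial in
   the next two definitions. *)
definition side_length :: "polygon \<Rightarrow> real" where
  "side_length P = dist (P ! 0) (P ! 1)"

definition apothem :: "polygon \<Rightarrow> real" where
  "apothem P = dist (center P) (midpoint (P ! 0) (P ! 1))"

(* The lowest edge is horizontal, and the labelling is chosen so that it joins vertex 0 to
   vertex 1.  As the vertices of a regular polygon are listed counterclockwise, vertex 0 is
   the left end of the base edge, and a regular polygon whose lowest edge is horizontal has
   exactly one labelling of this kind. *)
definition standard_orientation :: "polygon \<Rightarrow> bool" where
  "standard_orientation P \<longleftrightarrow>
     snd (P ! 0) = snd (P ! 1) \<and> (\<forall>v\<in>set P. snd (P ! 0) \<le> snd v)"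

definition base_mid :: "polygon \<Rightarrow> real \<times> real" where
  "base_mid P = center P - (0, apothem P)"

definition star_right :: "polygon \<Rightarrow> nat \<Rightarrow> real \<times> real" where
  "star_right P k = base_mid P + (apothem P * tan (real k * pi / real (length P)), 0)"

definition star_left :: "polygon \<Rightarrow> nat \<Rightarrow> real \<times> real" where
  "star_left P k = base_mid P - (apothem P * tan (real k * pi / real (length P)), 0)"

definition star_points :: "polygon \<Rightarrow> (real \<times> real) set" where
  "star_points P =
     {p. \<exists>k\<ge>1. real k < real (length P) / 2 \<and> (p = star_right P k \<or> p = star_left P k)}"

definition strict_half :: "nat \<Rightarrow> nat" where
  "strict_half m = (GREATEST j. real j < real m / 2)"

definition genstar_right :: "polygon \<Rightarrow> real \<times> real" where
  "genstar_right P = star_right P (strict_half (length P))"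

definition share_base_edge :: "polygon \<Rightarrow> polygon \<Rightarrow> bool" where
  "share_base_edge P Q \<longleftrightarrow> snd (P ! 0) = snd (Q ! 0)"

definition conforming :: "polygon \<Rightarrow> polygon \<Rightarrow> bool" where
  "conforming P Q \<longleftrightarrow>
     regular_polygon P \<and> standard_orientation P \<and> share_base_edge P Q \<and>
     (if even (length Q)
      then (length P = length Q \<or> length P = length Q div 2) \<and>
           genstar_right P = star_left Q 1
      else length P = 2 * length Q \<and>
           star_right P (length Q - 2) = star_left Q 1)"

(* "Another" star point is one different, as a point of the plane, from the star point
   "star_left Q 1" that every conforming polygon shares with Q.
   If Q is a square, no polygon with four sides is strongly conforming relative to Q and
   displaced by "- side_length Q / 2" from "star_left Q 1": with center 0 and apothem 1 for Q,
   that polygon is the congruent square with center (-2, 0), whose star points have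
   abscissas -3 and -1, while those of Q have abscissas -1 and 1. *)
definition strongly_conforming :: "polygon \<Rightarrow> polygon \<Rightarrow> bool" where
  "strongly_conforming P Q \<longleftrightarrow>
     conforming P Q \<and> (\<exists>p \<in> star_points P \<inter> star_points Q. p \<noteq> star_left Q 1)"

end

theory Submission
  imports Defs
begin

text \<open>A regular polygon in standard orientation is determined by its number of vertices, its
  center \<open>c\<close> and its apothem \<open>a\<close>. Put \<open>t = pi / N\<close> and let \<open>h\<close> be the apothem of \<open>N\<close>. The index of the star point of \<open>S[k]\<close> that
  has to coincide with the left \<open>star[1]\<close> of \<open>N\<close> belongs in both parities to the angle
  \<open>pi / 2 - t\<close>. Hence conformity and the prescribed displacement are linear conditions on \<open>c\<close>
  and \<open>a\<close>, with the unique solution \<open>a = h * tan t * tan (k * t)\<close>. The second common star point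
  comes from the addition formula
  \<open>tan ((k + 1) * t) = tan (k * t) + tan t + tan t * tan (k * t) * tan ((k + 1) * t)\<close>:
  if \<open>k + 1 < N / 2\<close> it is the left \<open>star[k + 1]\<close> of \<open>N\<close>. For the last \<open>k\<close> it is the left
  \<open>star[k]\<close> if \<open>N\<close> is even, and the right \<open>star[k]\<close> if \<open>N\<close> is odd.\<close>

text \<open>Angles are counted counterclockwise from the downward vertical, so vertices 0 and 1, at
  -pi/n and pi/n, bound the bottom edge. Dividing by the cosine turns the apothem \<open>a\<close>
  into the circumradius.\<close>

definition std_polygon :: "nat \<Rightarrow> real \<times> real \<Rightarrow> real \<Rightarrow> polygon" where
  "std_polygon n c a = map (\<lambda>j. c + (a / cos (pi / real n)) *\<^sub>R
     (sin ((2 * real j - 1) * pi / real n), - cos ((2 * real j - 1) * pi / real n))) [0..<n]"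

lemma length_std_polygon [simp]: "length (std_polygon n c a) = n"
  by (simp add: std_polygon_def)

lemma std_polygon_nth:
  "j < n \<Longrightarrow> std_polygon n c a ! j = c + (a / cos (pi / real n)) *\<^sub>R
     (sin ((2 * real j - 1) * pi / real n), - cos ((2 * real j - 1) * pi / real n))"
  by (simp add: std_polygon_def)

lemma cos_pi_div_pos: "n \<ge> 3 \<Longrightarrow> cos (pi / real n) > 0"
  by (rule cos_gt_zero) (auto simp: field_simps)

lemma sin_pi_div_pos: "n \<ge> 3 \<Longrightarrow> sin (pi / real n) > 0"
  by (rule sin_gt_zero) (auto simp: field_simps)

section \<open>Sums over equidistant angles\<close>

lemma sum_cis_equidistant:
  assumes "n \<ge> 2"
  shows "(\<Sum>j<n. cis (\<theta> + 2 * pi * real j / real n)) = 0"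
proof -
  \<comment> \<open>The sum is geometric with a ratio whose n-th power is 1. The ratio itself is not
    1, since 0 < 2 pi/n \<le> pi keeps its real part below 1.\<close>
  have "cos (2 * pi / real n) < cos 0"
    by (rule cos_monotone_0_pi) (use assms in \<open>auto simp: field_simps\<close>)
  then have "cis (2 * pi / real n) \<noteq> 1"
    by (auto simp: complex_eq_iff)
  then have "(\<Sum>j<n. cis (2 * pi / real n) ^ j) = 0"
    using assms by (subst geometric_sum) (auto simp: Complex.DeMoivre)
  moreover have "cis (\<theta> + 2 * pi * real j / real n) = cis \<theta> * cis (2 * pi / real n) ^ j" for j
    by (simp add: Complex.DeMoivre cis_mult mult_ac)
  ultimately show ?thesis
    by (simp flip: sum_distrib_left)
qed

lemma sum_cos_equidistant:
  "n \<ge> 2 \<Longrightarrow> (\<Sum>j<n. cos (\<theta> + 2 * pi * real j / real n)) = 0"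
  using arg_cong[OF sum_cis_equidistant[of n \<theta>], of Re] by simp

lemma sum_sin_equidistant:
  "n \<ge> 2 \<Longrightarrow> (\<Sum>j<n. sin (\<theta> + 2 * pi * real j / real n)) = 0"
  using arg_cong[OF sum_cis_equidistant[of n \<theta>], of Im] by simp

text \<open>Here \<alpha> points straight down. It is given by its cosine and sine instead of as
  -pi/2, because the start angle of an arbitrary regular polygon is known only modulo 2 pi.\<close>

lemma cos_sin_turned:
  assumes "cos \<alpha> = 0" "sin \<alpha> = -1"
  shows "cos (\<alpha> - pi / real n + 2 * pi * real j / real n) = sin ((2 * real j - 1) * pi / real n)"
    and "sin (\<alpha> - pi / real n + 2 * pi * real j / real n) = - cos ((2 * real j - 1) * pi / real n)"
proof -
  have "\<alpha> - pi / real n + 2 * pi * real j / real n = \<alpha> + (2 * real j - 1) * pi / real n"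
    by (simp add: algebra_simps diff_divide_distrib)
  then show "cos (\<alpha> - pi / real n + 2 * pi * real j / real n) = sin ((2 * real j - 1) * pi / real n)"
    "sin (\<alpha> - pi / real n + 2 * pi * real j / real n) = - cos ((2 * real j - 1) * pi / real n)"
    using assms by (simp_all only: cos_add sin_add)
qed

section \<open>Geometry of the normal form\<close>

lemma regular_std_polygon:
  assumes "n \<ge> 3" "a > 0"
  shows "regular_polygon (std_polygon n c a)"
  unfolding regular_polygon_def
proof (intro conjI exI allI impI)
  show "a / cos (pi / real n) > 0"
    using assms cos_pi_div_pos by simp
  fix j assume "j < length (std_polygon n c a)"
  then show "std_polygon n c a ! j = c + (a / cos (pi / real n)) *\<^sub>R
     (cos ((- (pi/2) - pi / real n) + 2 * pi * real j / real (length (std_polygon n c a))),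
      sin ((- (pi/2) - pi / real n) + 2 * pi * real j / real (length (std_polygon n c a))))"
    using cos_sin_turned[of "- (pi/2)" n j] by (simp add: std_polygon_nth)
qed (use assms in simp)

lemma standard_orientation_std_polygon:
  assumes "n \<ge> 3" "a > 0"
  shows "standard_orientation (std_polygon n c a)"
proof -
  have mono: "cos (x * pi / real n) \<le> cos (pi / real n)" if "1 \<le> x" "x \<le> real n" for x
  proof (rule cos_monotone_0_pi_le)
    show "pi / real n \<le> x * pi / real n"
      using that assms by (simp add: divide_right_mono)
    have "x * pi / real n \<le> real n * pi / real n"
      using that by (intro divide_right_mono mult_right_mono) auto
    then show "x * pi / real n \<le> pi"
      using assms by simp
  qed simp
  have low: "cos ((2 * real j - 1) * pi / real n) \<le> cos (pi / real n)" if "j < n" for j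
  proof -
    consider "j = 0" | "j \<ge> 1" "2 * j \<le> n + 1" | "j \<ge> 1" "2 * j > n + 1" by linarith
    then show ?thesis
    proof cases
      case 1
      then show ?thesis by simp
    next
      case 2
      then show ?thesis
        by (intro mono) linarith+
    next
      case 3
      \<comment> \<open>Beyond pi the angle is reflected in the vertical axis, back into the
        interval from pi/n to pi, where the cosine decreases.\<close>
      have "cos ((2 * real j - 1) * pi / real n) = cos (2 * pi - (2 * real j - 1) * pi / real n)"
        by (simp add: cos_diff)
      also have "2 * pi - (2 * real j - 1) * pi / real n = (2 * (real n - real j) + 1) * pi / real n"
        using assms by (simp add: field_simps)
      also have "cos \<dots> \<le> cos (pi / real n)"
        using 3 that by (intro mono) simp_all
      finally show ?thesis .
    qed
  qed
  have "snd (std_polygon n c a ! 0) \<le> snd (std_polygon n c a ! j)" if "j < n" for j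
    using that assms cos_pi_div_pos[of n] mult_left_mono[OF low[OF that], of a]
    by (simp add: std_polygon_nth field_simps)
  then have "\<forall>v\<in>set (std_polygon n c a). snd (std_polygon n c a ! 0) \<le> snd v"
    by (metis in_set_conv_nth length_std_polygon)
  moreover have "snd (std_polygon n c a ! 0) = snd (std_polygon n c a ! 1)"
    using assms by (simp add: std_polygon_nth)
  ultimately show ?thesis
    by (simp add: standard_orientation_def)
qed

lemma center_std_polygon:
  assumes "n \<ge> 3"
  shows "center (std_polygon n c a) = c"
proof -
  let ?v = "\<lambda>j. (cos ((- (pi/2) - pi / real n) + 2 * pi * real j / real n),
      sin ((- (pi/2) - pi / real n) + 2 * pi * real j / real n))"
  have "(\<Sum>j<n. std_polygon n c a ! j) = (\<Sum>j<n. c + (a / cos (pi / real n)) *\<^sub>R ?v j)"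
    using cos_sin_turned[of "- (pi/2)" n] by (intro sum.cong) (auto simp: std_polygon_nth)
  also have "\<dots> = real n *\<^sub>R c + (a / cos (pi / real n)) *\<^sub>R (\<Sum>j<n. ?v j)"
    by (simp add: sum.distrib scaleR_sum_right sum_constant_scaleR)
  also have "(\<Sum>j<n. ?v j) = 0"
    using assms by (simp add: prod_eq_iff fst_sum snd_sum sum_cos_equidistant sum_sin_equidistant)
  finally show ?thesis
    using assms by (simp add: center_def)
qed

lemma apothem_std_polygon:
  assumes "n \<ge> 3" "a > 0"
  shows "apothem (std_polygon n c a) = a"
  using assms cos_pi_div_pos[of n]
  by (simp add: apothem_def center_std_polygon std_polygon_nth midpoint_def dist_Pair_Pair
      dist_prod_def dist_real_def field_simps)

lemma side_length_std_polygon: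
  assumes "n \<ge> 3" "a > 0"
  shows "side_length (std_polygon n c a) = 2 * a * tan (pi / real n)"
  using assms cos_pi_div_pos[of n] sin_pi_div_pos[of n]
  by (simp add: side_length_def std_polygon_nth dist_prod_def dist_real_def tan_def)

lemma base_height_std_polygon:
  assumes "n \<ge> 3"
  shows "snd (std_polygon n c a ! 0) = snd c - a"
  using assms cos_pi_div_pos[of n] by (simp add: std_polygon_nth)

text \<open>Let \<alpha> be the direction from the center to the midpoint of the edge 0-1. A
  horizontal edge makes it vertical, and a lowest edge makes it point down rather than up.\<close>

lemma regular_polygon_standard_cases:
  assumes "regular_polygon P" "standard_orientation P"
  obtains c a where "length P \<ge> 3" "a > 0" "P = std_polygon (length P) c a"
proof -
  define n where "n = length P"
  from assms(1) obtain c r \<theta> where n: "n \<ge> 3" and r: "r > 0"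
    and P: "\<And>j. j < n \<Longrightarrow> P ! j = c + r *\<^sub>R (cos (\<theta> + 2 * pi * real j / real n),
                                       sin (\<theta> + 2 * pi * real j / real n))"
    unfolding regular_polygon_def n_def by blast
  define \<alpha> where "\<alpha> = \<theta> + pi / real n"
  have sc: "sin (pi / real n) > 0" "cos (pi / real n) > 0"
    using n sin_pi_div_pos cos_pi_div_pos by auto
  have \<theta>: "\<theta> = \<alpha> - pi / real n" "\<theta> + 2 * pi / real n = \<alpha> + pi / real n"
    by (simp_all add: \<alpha>_def)
  have "sin (\<alpha> - pi / real n) = sin (\<alpha> + pi / real n)"
    using assms(2) n r P[of 0] P[of 1] \<theta> by (simp add: standard_orientation_def add.commute)
  then have cos0: "cos \<alpha> = 0"
    using sc by (simp add: sin_add sin_diff)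
  \<comment> \<open>The heights of the vertices relative to the center sum to 0, so a lowest vertex
    cannot lie above the center.\<close>
  have "sin \<theta> \<le> 0"
  proof -
    have "sin \<theta> \<le> sin (\<theta> + 2 * pi * real j / real n)" if "j < n" for j
    proof -
      have "snd (P ! 0) \<le> snd (P ! j)"
        using assms(2) that unfolding standard_orientation_def n_def by (blast intro: nth_mem)
      then show ?thesis using P[of 0] P[of j] that r n by simp
    qed
    then have "(\<Sum>j<n. sin \<theta>) \<le> (\<Sum>j<n. sin (\<theta> + 2 * pi * real j / real n))"
      by (intro sum_mono) auto
    then show ?thesis
      using n by (simp add: sum_sin_equidistant mult_le_0_iff)
  qed
  moreover have "sin \<theta> = sin \<alpha> * cos (pi / real n)"
    using \<theta>(1) cos0 by (simp add: sin_diff)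
  moreover have "sin \<alpha> = 1 \<or> sin \<alpha> = -1"
    using cos0 sin_cos_squared_add[of \<alpha>] by (simp add: power2_eq_1_iff)
  ultimately have sin1: "sin \<alpha> = -1"
    using sc by auto
  have "P = std_polygon n c (r * cos (pi / real n))"
  proof (rule nth_equalityI)
    fix j assume "j < length P"
    then show "P ! j = std_polygon n c (r * cos (pi / real n)) ! j"
      using P[of j] cos_sin_turned[OF cos0 sin1, of n j] sc
      by (simp add: std_polygon_nth n_def \<theta>(1))
  qed (simp add: n_def)
  then show ?thesis
    using that[of "r * cos (pi / real n)" c] n r sc by (simp add: n_def)
qed

section \<open>Star points and conformity in coordinates\<close>

lemma strict_half_even:
  assumes "even n" "n \<ge> 2"
  shows "strict_half n = n div 2 - 1"
  unfolding strict_half_def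
  by (rule Greatest_equality) (use assms in \<open>auto elim!: evenE\<close>)

lemma star_std_polygon:
  assumes "n \<ge> 3" "a > 0"
  shows "star_right (std_polygon n c a) j = (fst c + a * tan (real j * pi / real n), snd c - a)"
    and "star_left (std_polygon n c a) j = (fst c - a * tan (real j * pi / real n), snd c - a)"
  using assms
  by (simp_all add: star_right_def star_left_def base_mid_def center_std_polygon
      apothem_std_polygon prod_eq_iff)

lemma star_points_std_polygonI:
  assumes "n \<ge> 3" "a > 0" "j \<ge> 1" "real j < real n / 2"
    and "x = fst c + a * tan (real j * pi / real n) \<or> x = fst c - a * tan (real j * pi / real n)"
    and "y = snd c - a"
  shows "(x, y) \<in> star_points (std_polygon n c a)"
  using assms unfolding star_points_def by (force simp: star_std_polygon)

lemma tan_complement: "tan (pi / 2 - x) = 1 / tan x"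
  by (simp add: tan_cot' cot_altdef inverse_eq_divide)

text \<open>The shared star point lies at angle pi/2 - pi/N, whose tangent is the reciprocal of tan
  (pi/N); hence its offset \<open>a / tan (pi / real N)\<close> from the center's abscissa. For even
  N, \<open>m\<close> selects the larger of the two sizes that conformity admits.\<close>

lemma conforming_std_polygon_iff:
  assumes "N \<ge> 3" "h > 0" "a > 0" and m: "m = (if even N then N else 2 * N)"
  shows "conforming (std_polygon m c a) (std_polygon N d h) \<longleftrightarrow>
     snd c - a = snd d - h \<and>
     fst c + a / tan (pi / real N) = fst d - h * tan (pi / real N)"
proof -
  have m3: "m \<ge> 3" using assms by auto
  \<comment> \<open>The first value is the \<open>GenStar\<close> index of an N-gon with N even, the
    second the index prescribed for a 2N-gon.\<close>
  define g where "g = (if even N then N div 2 - 1 else N - 2)"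
  have "real g * pi / real m = pi / 2 - pi / real N"
  proof (cases "even N")
    case True
    then obtain q where q: "N = 2 * q" by (elim evenE)
    with assms True show ?thesis by (simp add: g_def of_nat_diff field_simps)
  next
    case False
    with assms show ?thesis by (simp add: g_def of_nat_diff field_simps)
  qed
  then have g: "tan (real g * pi / real m) = 1 / tan (pi / real N)"
    by (simp add: tan_complement)
  have "conforming (std_polygon m c a) (std_polygon N d h) \<longleftrightarrow>
      snd c - a = snd d - h \<and>
      star_right (std_polygon m c a) g = star_left (std_polygon N d h) 1"
    using assms m3 strict_half_even[of N]
    by (auto simp: conforming_def regular_std_polygon standard_orientation_std_polygon
        share_base_edge_def base_height_std_polygon g_def genstar_right_def)
  then show ?thesis
    unfolding star_std_polygon[OF m3 assms(3)] star_std_polygon[OF assms(1,2)] g by auto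
qed

section \<open>The second common star point\<close>

lemma tan_add_cleared:
  fixes x y :: real
  assumes "cos x \<noteq> 0" "cos y \<noteq> 0" "cos (x + y) \<noteq> 0"
  shows "tan (x + y) = tan x + tan y + tan x * tan y * tan (x + y)"
proof -
  \<comment> \<open>This quotient shows that the denominator of the usual addition formula is
    nonzero, so it may be cleared.\<close>
  have "1 - tan x * tan y = cos (x + y) / (cos x * cos y)"
    using assms by (simp add: tan_def cos_add field_simps)
  then have "1 - tan x * tan y \<noteq> 0" using assms by simp
  then show ?thesis
    using tan_add[OF assms] by (simp add: field_simps)
qed

text \<open>The condition \<open>N \<noteq> 4\<close> serves the last k of an even N: the common
  point found there is the left \<open>star[k]\<close>, which for a square would be
  \<open>star[1]\<close> itself.\<close>

lemma strongly_conforming_std_polygon: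
  assumes N: "N \<ge> 3" "N \<noteq> 4" and h: "h > 0" and k: "1 \<le> k" "real k < real N / 2"
    and m: "m = (if even N then N else 2 * N)"
    and a: "a = h * tan (pi / real N) * tan (real k * pi / real N)"
    and c: "fst c = fst d - h * tan (real k * pi / real N) - h * tan (pi / real N)"
      "snd c = snd d - h + a"
    and conf: "conforming (std_polygon m c a) (std_polygon N d h)"
  shows "strongly_conforming (std_polygon m c a) (std_polygon N d h)"
proof -
  let ?t = "\<lambda>i. tan (real i * pi / real N)"
  have m3: "m \<ge> 3" using N m by auto
  have t_pos: "?t i > 0" if "1 \<le> i" "real i < real N / 2" for i
    by (rule tan_gt_zero) (use that in \<open>auto simp: field_simps\<close>)
  have t_less: "?t 1 < ?t i" if "2 \<le> i" "real i < real N / 2" for i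
  proof (rule tan_monotone)
    have "0 < real 1 * pi / real N" using N by simp
    then show "- (pi / 2) < real 1 * pi / real N" using pi_gt_zero by linarith
  qed (use that N in \<open>auto simp: field_simps\<close>)
  have a_pos: "a > 0"
    using t_pos[of 1] t_pos[of k] k N h a by simp
  have a': "a = h * ?t 1 * ?t k" and c': "fst c = fst d - h * ?t k - h * ?t 1"
    using a c by simp_all
  have cos_pos: "cos (real i * pi / real N) > 0" if "real i < real N / 2" for i
  proof (rule cos_gt_zero_pi)
    have "0 \<le> real i * pi / real N" by simp
    then show "- (pi / 2) < real i * pi / real N" using pi_gt_zero by linarith
  qed (use that N in \<open>auto simp: field_simps\<close>)
  have cosk: "cos (real k * pi / real N) \<noteq> 0" "cos (pi / real N) \<noteq> 0"
    using cos_pos[of k] cos_pi_div_pos[of N] k N by auto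
  have t_Suc: "?t (Suc k) = ?t k + ?t 1 + ?t k * ?t 1 * ?t (Suc k)"
    if "cos (real (Suc k) * pi / real N) \<noteq> 0"
  proof -
    have "real (Suc k) * pi / real N = real k * pi / real N + pi / real N"
      by (simp add: algebra_simps add_divide_distrib)
    then show ?thesis
      using tan_add_cleared[of "real k * pi / real N" "pi / real N"] that cosk by simp
  qed
  obtain x where x: "(x, snd d - h) \<in> star_points (std_polygon m c a)"
    "(x, snd d - h) \<in> star_points (std_polygon N d h)" "x \<noteq> fst d - h * ?t 1"
  proof -
    \<comment> \<open>The last index is N/2 - 1 for even N and (N - 1)/2 for odd N.\<close>
    consider (inner) "real (Suc k) < real N / 2" | (even) q where "N = 2 * q" "k = q - 1"
      | (odd) "N = 2 * k + 1"
    proof (cases "real (Suc k) < real N / 2")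
      case False
      show ?thesis
      proof (cases "even N")
        case True
        then show ?thesis using that(2)[of "N div 2"] False k by (auto elim!: evenE)
      next
        case odd: False
        then show ?thesis using that(3) False k by (auto elim!: oddE)
      qed
    qed (use that in blast)
    then show ?thesis
    proof cases
      case inner
      \<comment> \<open>A 2N-gon needs twice the index to reach the same angle.\<close>
      define j where "j = (if even N then Suc k else 2 * Suc k)"
      have j: "real j * pi / real m = real (Suc k) * pi / real N"
        using N by (simp add: j_def m divide_simps)
      have "cos (real (Suc k) * pi / real N) \<noteq> 0"
        using cos_pos[of "Suc k"] inner by simp
      note T = t_Suc[OF this]
      \<comment> \<open>Multiplied by \<open>h\<close>, the addition formula ends in
        \<open>a * ?t (Suc k)\<close>, and its other terms are the offset between the two
        centers.\<close>
      have "fst d - h * ?t (Suc k) = fst c - a * ?t (Suc k)"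
        by (subst T) (simp add: a' c' algebra_simps)
      then have eq: "fst d - h * ?t (Suc k) = fst c - a * tan (real j * pi / real m)"
        by (simp only: j)
      have j_bounds: "1 \<le> j" "real j < real m / 2"
        using inner by (auto simp: j_def m)
      show ?thesis
      proof (rule that)
        show "(fst d - h * ?t (Suc k), snd d - h) \<in> star_points (std_polygon m c a)"
          by (rule star_points_std_polygonI[where j = j], fact m3, fact a_pos)
            (use eq j_bounds c(2) in simp_all)
        show "(fst d - h * ?t (Suc k), snd d - h) \<in> star_points (std_polygon N d h)"
          by (rule star_points_std_polygonI[where j = "Suc k"]) (use N h inner in simp_all)
        show "fst d - h * ?t (Suc k) \<noteq> fst d - h * ?t 1"
          using t_less[of "Suc k"] inner k h by simp
      qed
    next
      case even
      then have ang: "real k * pi / real N = pi / 2 - pi / real N"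
        using N by (simp add: of_nat_diff field_simps)
      \<comment> \<open>The two angles are complementary. Hence the tile is congruent to N, and its
        right \<open>star[1]\<close> is the left \<open>star[k]\<close> of N.\<close>
      have "?t 1 * ?t k = 1"
        using t_pos[of 1] N unfolding ang tan_complement by simp
      then have "a = h" using a' by simp
      show ?thesis
      proof (rule that)
        show "(fst d - h * ?t k, snd d - h) \<in> star_points (std_polygon m c a)"
          by (rule star_points_std_polygonI[where j = 1], fact m3, fact a_pos)
            (use \<open>a = h\<close> even N c m in simp_all)
        show "(fst d - h * ?t k, snd d - h) \<in> star_points (std_polygon N d h)"
          by (rule star_points_std_polygonI[where j = k]) (use N h k in simp_all)
        show "fst d - h * ?t k \<noteq> fst d - h * ?t 1"
          using t_less[of k] even N k h by force
      qed
    next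
      case odd
      have ang: "real (Suc k) * pi / real N = pi - real k * pi / real N"
        using N odd by (simp add: field_simps)
      have "?t (Suc k) = - ?t k" "cos (real (Suc k) * pi / real N) \<noteq> 0"
        unfolding ang using cosk by (simp_all add: tan_def)
      \<comment> \<open>Since \<open>t_Suc\<close> asks only for a nonzero cosine, it still applies
        although (k + 1) pi/N exceeds pi/2; there the tangent is the negative of
        \<open>?t k\<close>. Mapping the rearranged identity by \<open>fst d + h * z\<close> yields
        a star point to the right of the base midpoint.\<close>
      with t_Suc have "- ?t k = ?t k + ?t 1 - ?t k * ?t 1 * ?t k" by simp
      then have "?t k = - ?t k - ?t 1 + ?t 1 * ?t k * ?t k" by (simp add: algebra_simps)
      from arg_cong[OF this, of "\<lambda>z. fst d + h * z"]
      have eq: "fst d + h * ?t k = fst c + a * ?t k"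
        by (simp add: a' c' algebra_simps)
      have j: "real (2 * k) * pi / real m = real k * pi / real N"
      proof -
        have "m = 2 * N" using odd by (simp add: m)
        then show ?thesis using N by (simp add: divide_simps)
      qed
      \<comment> \<open>This is 2k < N = 2k + 1, so 2k is the last index of the 2N-gon.\<close>
      have j2: "real (2 * k) < real m / 2"
        using odd by (simp add: m)
      have "h * ?t k > 0" "h * ?t 1 > 0" using t_pos[of k] t_pos[of 1] k h N by simp_all
      then have "fst d + h * ?t k \<noteq> fst d - h * ?t 1" by linarith
      show ?thesis
      proof (rule that)
        show "(fst d + h * ?t k, snd d - h) \<in> star_points (std_polygon m c a)"
          by (rule star_points_std_polygonI[where j = "2 * k"], fact m3, fact a_pos)
            (use j2 k c(2) eq in \<open>simp_all only: j, simp_all\<close>)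
        show "(fst d + h * ?t k, snd d - h) \<in> star_points (std_polygon N d h)"
          by (rule star_points_std_polygonI[where j = k]) (use N h k in simp_all)
        show "fst d + h * ?t k \<noteq> fst d - h * ?t 1"
          by fact
      qed
    qed
  qed
  then show ?thesis
    using conf N h unfolding strongly_conforming_def
    by (auto simp: star_std_polygon intro!: bexI[of _ "(x, snd d - h)"])
qed

section \<open>Existence and uniqueness of the tile\<close>

theorem theorem2p1:
  fixes P :: polygon and N k :: nat
  assumes "regular_polygon P" and "length P = N" and "standard_orientation P"
    and "1 \<le> k" and "real k < real N / 2"
  shows "\<exists>!S. regular_polygon S \<and> standard_orientation S \<and>
           length S = (if even N then N else 2 * N) \<and>
           conforming S P \<and>
           (N \<noteq> 4 \<longrightarrow> strongly_conforming S P) \<and>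
           fst (center S) = fst (star_left P k) - side_length P / 2"
proof -
  obtain d h where N: "N \<ge> 3" and h: "h > 0" and P: "P = std_polygon N d h"
    using regular_polygon_standard_cases[OF assms(1,3)] assms(2) by metis
  define m where "m = (if even N then N else 2 * N)"
  define t where "t = tan (pi / real N)"
  \<comment> \<open>The prescribed abscissa of the center is \<open>x\<close>. Solving the
    conformity equation \<open>x + a / t = fst d - h * t\<close> gives this \<open>a\<close>, and
    \<open>c\<close> lies at height \<open>a\<close> above the common base line.\<close>
  define a where "a = h * tan (pi / real N) * tan (real k * pi / real N)"
  define x where "x = fst d - h * tan (real k * pi / real N) - h * tan (pi / real N)"
  define c where "c = (x, snd d - h + a)"
  have m3: "m \<ge> 3" using N m_def by auto
  have t: "t > 0"
    unfolding t_def by (rule tan_gt_zero) (use N in \<open>auto simp: field_simps\<close>)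
  have "tan (real k * pi / real N) > 0"
    by (rule tan_gt_zero) (use assms in \<open>auto simp: field_simps\<close>)
  then have a: "a > 0" using h t by (simp add: a_def t_def)
  have x: "fst (star_left P k) - side_length P / 2 = x"
    using N h by (simp add: P star_std_polygon side_length_std_polygon x_def)
  have conf: "conforming (std_polygon m c a) P"
    unfolding P conforming_std_polygon_iff[OF N h a m_def]
    using t by (simp add: c_def x_def a_def t_def)
  show ?thesis
    unfolding x m_def[symmetric]
  proof (rule ex1I[of _ "std_polygon m c a"])
    have "N \<noteq> 4 \<longrightarrow> strongly_conforming (std_polygon m c a) P"
      using strongly_conforming_std_polygon[OF N _ h assms(4,5) m_def a_def, of c d] conf
      by (simp add: P c_def x_def)
    then show "regular_polygon (std_polygon m c a) \<and> standard_orientation (std_polygon m c a) \<and>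
        length (std_polygon m c a) = m \<and> conforming (std_polygon m c a) P \<and>
        (N \<noteq> 4 \<longrightarrow> strongly_conforming (std_polygon m c a) P) \<and>
        fst (center (std_polygon m c a)) = x"
      using conf m3 a
      by (simp add: regular_std_polygon standard_orientation_std_polygon center_std_polygon c_def)
  next
    fix S
    assume S: "regular_polygon S \<and> standard_orientation S \<and> length S = m \<and> conforming S P \<and>
        (N \<noteq> 4 \<longrightarrow> strongly_conforming S P) \<and> fst (center S) = x"
    \<comment> \<open>In normal form the displacement fixes the abscissa of the center, the equation
      for the shared star point then fixes the apothem, and the common base line fixes the
      height.\<close>
    then obtain c' a' where a': "a' > 0" and S': "S = std_polygon m c' a'"
      using regular_polygon_standard_cases by metis
    have "conforming (std_polygon m c' a') (std_polygon N d h)"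
      using S S' P by simp
    then have "snd c' - a' = snd d - h" "fst c' + a' / t = fst d - h * t"
      unfolding conforming_std_polygon_iff[OF N h a' m_def] t_def by auto
    moreover have "fst c' = x"
      using S S' m3 by (simp add: center_std_polygon)
    ultimately have "a' / t = a / t" "snd c' = snd d - h + a'"
      using t by (simp_all add: x_def a_def t_def)
    with t \<open>fst c' = x\<close> have "a' = a" "c' = c"
      by (auto simp: c_def prod_eq_iff)
    then show "S = std_polygon m c a" by (simp add: S')
  qed
qed

end
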